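(* Let $d\ge1$, $N\ge1$, let $\phi(\cdot;\mathfrak r_1),\ldots,\phi(\cdot;\mathfrak r_d)$ be densities of laws $\mu(\mathfrak r_1),\ldots,\mu(\mathfrak r_d)$ in a Meixner class $\mathcal M(\mathfrak u)$, and let $\overline\phi(\cdot;\overline{\mathfrak r}_1),\ldots,\overline\phi(\cdot;\overline{\mathfrak r}_d)$ be densities (with respect to the same reference measure on $\mathbb R$) of laws with parameters $\overline{\mathfrak r}_1,\ldots,\overline{\mathfrak r}_d$ in a possibly different Meixner class $\mathcal M(\overline{\mathfrak u})$, whose polynomials and squared norms are denoted $\overline P_n(\cdot;\overline{\mathfrak r}_i)$ and $\overline{\mathfrak h}_n(\overline{\mathfrak r}_i)$. Let $\kappa\ne0$ and $H_n\in\mathbb R$ for $n=(n_1,\ldots,n_d)$ with non-negative integer entries and $1\le n_1+\cdots+n_d\le N$. Suppose that $$\varphi(x)=\prod_{i=1}^d\phi(x_i;\mathfrak r_i)+\kappa\prod_{i=1}^d\overline\phi(x_i;\overline{\mathfrak r}_i)\sum_{1\le n_1+\cdots+n_d\le N}H_n\prod_{i=1}^d\overline P_{n_i}(x_i;\overline{\mathfrak r}_i)$$ is a probability density. Let $Y$ have density $\varphi(x)$ and let $X$ have density $\prod_{i=1}^d\phi(x_i;\mathfrak r_i)$. Then $Y_1+\cdots+Y_d$ and $X_1+\cdots+X_d$ have the same law if and only if, for every $1\le m\le N$, $$\sum_{n_1+\cdots+n_d=m}H_n\frac1{\prod_{i=1}^dn_i!}\prod_{i=1}^d\overline{\mathfrak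 h}_{n_i}(\overline{\mathfrak r}_i)=0.$$
   Context: Meixner classes. Let $\mathfrak u$ be a real function with a power series expansion near $0$, $\mathfrak u(0)=0$, $\mathfrak u'(0)=1$. The Meixner class $\mathcal M(\mathfrak u)$ is the set of probability laws $\mu$ on $\mathbb R$ with positive variance, whose moment generating function $M(t)=\int e^{tx}\mu(dx)$ is finite in an open interval containing $0$, and such that the polynomials $P_n$ (monic of degree $n$) defined by $\frac{e^{x\mathfrak u(z)}}{M(\mathfrak u(z))}=\sum_{n\ge0}P_n(x)\frac{z^n}{n!}$ for $z$ near $0$ are orthogonal: $\int P_mP_n\,d\mu=0$ for $m\ne n$. With $\mathfrak v$ the inverse of $\mathfrak u$ near $0$, one has $M'(t)/M(t)=\mathfrak s^2\mathfrak v(t)+\mathfrak m$, where $\mathfrak m,\mathfrak s^2$ are the mean and variance of $\mu$; hence a law in $\mathcal M(\mathfrak u)$ is determined by $\mathfrak r=(\mathfrak m,\mathfrak s^2)$ and is denoted $\mu(\mathfrak r)$; its polynomials are $P_n(\cdot;\mathfrak r)$ and $\mathfrak h_n(\mathfrak r)=\int P_n(x;\mathfrak r)^2\mu(\mathfrak r)(dx)$ (bars denote the analogous objects for $\overline{\mathfrak u}$). It is known that $(P_n(\cdot;\mathfrak r))_n$ is a complete orthogonal system in $L^2(\mu(\mathfrak r))$, and that if $\mu(\mathfrak r_1),\mu(\mathfrak r_2)\in\mathcal M(\mathfrak u)$ then $\mu(\mathfrak r_1)*\mu(\mathfrak r_2)=\mu(\mathfrak r_1+\mathfrak r_2)\in\mathcal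 M(\mathfrak u)$. Densities on $\mathbb R$ are with respect to a fixed common $\sigma$-finite reference measure (e.g. Lebesgue measure, or counting measure on a countable set for discrete classes), and densities on $\mathbb R^d$ are with respect to its $d$-fold product. *)

theory Defs
  imports "HOL-Probability.Probability" "HOL-Computational_Algebra.Polynomial"
begin

definition meixner_generator :: "(real \<Rightarrow> real) \<Rightarrow> bool" where
  "meixner_generator u \<longleftrightarrow>
     (\<exists>U. u has_fps_expansion U) \<and> u 0 = 0 \<and> (u has_real_derivative 1) (at 0)"

definition mgf :: "real measure \<Rightarrow> real \<Rightarrow> real" where
  "mgf \<mu> t = (\<integral>x. exp (t * x) \<partial>\<mu>)"

definition mgf_finite_near_0 :: "real measure \<Rightarrow> bool" where
  "mgf_finite_near_0 \<mu> \<longleftrightarrow>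
     (\<exists>a b. a < 0 \<and> 0 < b \<and> (\<forall>t\<in>{a<..<b}. integrable \<mu> (\<lambda>x. exp (t * x))))"

text \<open>By uniqueness of power series coefficients, at most one sequence \<open>P\<close> satisfies the following
  for given \<open>u\<close> and \<open>\<mu>\<close>.\<close>

definition meixner_polys :: "(real \<Rightarrow> real) \<Rightarrow> real measure \<Rightarrow> (nat \<Rightarrow> real poly) \<Rightarrow> bool" where
  "meixner_polys u \<mu> P \<longleftrightarrow>
     (\<forall>n. degree (P n) = n \<and> lead_coeff (P n) = 1) \<and>
     (\<forall>x. (\<lambda>z. exp (x * u z) / mgf \<mu> (u z))
             has_fps_expansion Abs_fps (\<lambda>n. poly (P n) x / fact n))"

definition meixner_class :: "(real \<Rightarrow> real) \<Rightarrow> real measure set" where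
  "meixner_class u = {\<mu>. real_distribution \<mu> \<and> prob_space.variance \<mu> (\<lambda>x. x) > 0 \<and>
     mgf_finite_near_0 \<mu> \<and>
     (\<exists>P. meixner_polys u \<mu> P \<and>
          (\<forall>m n. m \<noteq> n \<longrightarrow> (\<integral>x. poly (P m) x * poly (P n) x \<partial>\<mu>) = 0))}"

text \<open>A parameter is the pair (mean, variance); there is at most one law in the class with a
  given parameter.\<close>

definition has_parameter :: "real measure \<Rightarrow> real \<times> real \<Rightarrow> bool" where
  "has_parameter \<mu> r \<longleftrightarrow>
     prob_space.expectation \<mu> (\<lambda>x. x) = fst r \<and> prob_space.variance \<mu> (\<lambda>x. x) = snd r"

definition sq_norm :: "real measure \<Rightarrow> real poly \<Rightarrow> real" where
  "sq_norm \<mu> p = (\<integral>x. (poly p x)\<^sup>2 \<partial>\<mu>)"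

definition prob_density :: "'a measure \<Rightarrow> ('a \<Rightarrow> real) \<Rightarrow> bool" where
  "prob_density M f \<longleftrightarrow>
     f \<in> borel_measurable M \<and> (AE x in M. 0 \<le> f x) \<and> (\<integral>\<^sup>+x. ennreal (f x) \<partial>M) = 1"

definition is_density_of :: "'a measure \<Rightarrow> ('a \<Rightarrow> real) \<Rightarrow> 'a measure \<Rightarrow> bool" where
  "is_density_of M f \<mu> \<longleftrightarrow> prob_density M f \<and> \<mu> = density M (\<lambda>x. ennreal (f x))"

text \<open>Vectors of length \<open>d\<close> are functions on \<open>{1..d}\<close>, extended by \<open>undefined\<close> as in \<open>PiM\<close>;
  \<open>multi_indices d S\<close> collects the multi-indices whose total degree lies in \<open>S\<close>.\<close>

definition multi_indices :: "nat \<Rightarrow> nat set \<Rightarrow> (nat \<Rightarrow> nat) set" where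
  "multi_indices d S = {n \<in> {1..d} \<rightarrow>\<^sub>E UNIV. (\<Sum>i=1..d. n i) \<in> S}"

end

(* Compare the Laplace transforms of the two sums. Orthogonality of the Meixner polynomials and the
   generating function exp(x u(z)) / M(u(z)) give, for z near 0,
     E[P_n(X) exp(u(z) X)] = M(u(z)) h_n z^n / n!.
   Applied with u' to the product density, this says that at t = u'(z) the transforms of Y_1 + ... + Y_d
   and X_1 + ... + X_d differ by kappa * prod_i M_i(u'(z)) * sum_m c_m z^m, where c_m is the m-th sum of
   the criterion. If the laws agree, the polynomial vanishes near 0, so all c_m are 0. Conversely, if
   all c_m are 0, the transforms agree on the values of u' near 0; these accumulate at 0, so by analytic
   continuation in a vertical strip the characteristic functions agree, and so do the laws. *)

theory Submission
  imports Defs "HOL-Complex_Analysis.Complex_Analysis"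
begin

section \<open>Laplace transforms near the origin\<close>

text \<open>The symmetric interval lets exponentials in |x| be dominated by
  \<open>exp (t * x) + exp ((- t) * x)\<close> and lets finitely many laws share one radius. Total
  mass is left free.\<close>

definition exp_integrable_on :: "real measure \<Rightarrow> real \<Rightarrow> bool" where
  "exp_integrable_on \<mu> \<epsilon> \<longleftrightarrow>
     sets \<mu> = sets borel \<and> (\<forall>t. \<bar>t\<bar> < \<epsilon> \<longrightarrow> integrable \<mu> (\<lambda>x. exp (t * x)))"

lemma borel_measurable_poly [measurable]: "poly (p :: real poly) \<in> borel_measurable borel"
  by (intro borel_measurable_continuous_onI continuous_intros)

text \<open>Each factor x of the polynomial costs an arbitrarily small increase of the exponent: |x|
  is at most a constant times an exponential of rate \<sigma> - \<rho>. Hence the induction on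
  \<open>p\<close> with \<rho> varying.\<close>

lemma exp_integrable_on_poly:
  assumes "exp_integrable_on \<mu> \<epsilon>" "\<rho> < \<epsilon>" "0 < \<epsilon>"
  shows "integrable \<mu> (\<lambda>x. poly p x * exp (\<rho> * \<bar>x\<bar>))"
  using assms(2)
proof (induction p arbitrary: \<rho>)
  case (pCons a p)
  have [measurable_cong]: "sets \<mu> = sets borel"
    and int: "\<And>t. \<bar>t\<bar> < \<epsilon> \<Longrightarrow> integrable \<mu> (\<lambda>x. exp (t * x))"
    using assms(1) by (auto simp: exp_integrable_on_def)
  \<comment> \<open>The maximum with 0 keeps \<sigma> in (0, \<epsilon>) even for very negative
    \<rho>, so that both exponentials of rate \<sigma> and -\<sigma> are integrable.\<close>
  define \<sigma> where "\<sigma> = (max \<rho> 0 + \<epsilon>) / 2"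
  have \<sigma>: "\<rho> < \<sigma>" "0 < \<sigma>" "\<sigma> < \<epsilon>"
    using pCons.prems assms(3) by (auto simp: \<sigma>_def)
  have "integrable \<mu> (\<lambda>x. exp (\<rho> * \<bar>x\<bar>))"
  proof (rule Bochner_Integration.integrable_bound)
    show "integrable \<mu> (\<lambda>x. exp (\<sigma> * x) + exp ((- \<sigma>) * x))"
      using \<sigma> by (intro Bochner_Integration.integrable_add int) auto
    show "AE x in \<mu>. norm (exp (\<rho> * \<bar>x\<bar>)) \<le> norm (exp (\<sigma> * x) + exp ((- \<sigma>) * x))"
    proof (intro AE_I2)
      fix x
      have "exp (\<rho> * \<bar>x\<bar>) \<le> exp (\<sigma> * \<bar>x\<bar>)"
        using \<sigma> by (simp add: mult_right_mono)
      also have "\<dots> \<le> exp (\<sigma> * x) + exp ((- \<sigma>) * x)"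
        by (cases "0 \<le> x") auto
      finally show "norm (exp (\<rho> * \<bar>x\<bar>)) \<le> norm (exp (\<sigma> * x) + exp ((- \<sigma>) * x))"
        by simp
    qed
  qed simp
  moreover have "integrable \<mu> (\<lambda>x. x * (poly p x * exp (\<rho> * \<bar>x\<bar>)))"
  proof (rule Bochner_Integration.integrable_bound)
    show "integrable \<mu> (\<lambda>x. 1 / (\<sigma> - \<rho>) * (poly p x * exp (\<sigma> * \<bar>x\<bar>)))"
      using pCons.IH[OF \<sigma>(3)] by simp
    show "AE x in \<mu>. norm (x * (poly p x * exp (\<rho> * \<bar>x\<bar>)))
            \<le> norm (1 / (\<sigma> - \<rho>) * (poly p x * exp (\<sigma> * \<bar>x\<bar>)))"
    proof (intro AE_I2)
      fix x
      have "(\<sigma> - \<rho>) * \<bar>x\<bar> \<le> exp ((\<sigma> - \<rho>) * \<bar>x\<bar>)"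
        using exp_ge_add_one_self[of "(\<sigma> - \<rho>) * \<bar>x\<bar>"] by linarith
      hence "\<bar>x\<bar> * exp (\<rho> * \<bar>x\<bar>) \<le> 1 / (\<sigma> - \<rho>) * exp ((\<sigma> - \<rho>) * \<bar>x\<bar>) * exp (\<rho> * \<bar>x\<bar>)"
        using \<sigma> by (intro mult_right_mono) (auto simp: field_simps)
      also have "\<dots> = 1 / (\<sigma> - \<rho>) * exp (\<sigma> * \<bar>x\<bar>)"
        by (simp add: exp_add[symmetric] algebra_simps)
      finally have "\<bar>poly p x\<bar> * (\<bar>x\<bar> * exp (\<rho> * \<bar>x\<bar>)) \<le> \<bar>poly p x\<bar> * (1 / (\<sigma> - \<rho>) * exp (\<sigma> * \<bar>x\<bar>))"
        by (intro mult_left_mono) auto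
      thus "norm (x * (poly p x * exp (\<rho> * \<bar>x\<bar>)))
            \<le> norm (1 / (\<sigma> - \<rho>) * (poly p x * exp (\<sigma> * \<bar>x\<bar>)))"
        using \<sigma> by (simp add: abs_mult mult_ac)
    qed
  qed simp
  ultimately show ?case
    by (simp add: algebra_simps)
qed auto

lemma exp_integrable_on_poly_exp:
  assumes "exp_integrable_on \<mu> \<epsilon>" "\<bar>t\<bar> < \<epsilon>"
  shows "integrable \<mu> (\<lambda>x. poly p x * exp (t * x))"
proof (rule Bochner_Integration.integrable_bound)
  have [measurable_cong]: "sets \<mu> = sets borel"
    using assms(1) by (auto simp: exp_integrable_on_def)
  show "integrable \<mu> (\<lambda>x. poly p x * exp (\<bar>t\<bar> * \<bar>x\<bar>))"
    using assms by (intro exp_integrable_on_poly) auto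
  have "t * x \<le> \<bar>t\<bar> * \<bar>x\<bar>" for x
    by (metis abs_mult abs_ge_self)
  thus "AE x in \<mu>. norm (poly p x * exp (t * x)) \<le> norm (poly p x * exp (\<bar>t\<bar> * \<bar>x\<bar>))"
    by (auto simp: abs_mult intro!: mult_left_mono)
  show "(\<lambda>x. poly p x * exp (t * x)) \<in> borel_measurable \<mu>"
    by measurable
qed

text \<open>The exponential series is integrated term by term. The single function
  \<open>norm (g x) * exp (norm h * \<bar>x\<bar>)\<close> dominates all partial sums of norms,
  which gives both integrability of the terms and summability of their integrals. The field is
  general because real expansions and complex holomorphy are both drawn from it.\<close>

lemma laplace_transform_sums:
  fixes g :: "real \<Rightarrow> 'a::{banach, real_normed_field, second_countable_topology}"
  assumes [measurable_cong]: "sets \<mu> = sets borel" and [measurable]: "g \<in> borel_measurable borel"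
    and int: "integrable \<mu> (\<lambda>x. norm (g x) * exp (norm h * \<bar>x\<bar>))"
  shows "(\<lambda>k. (\<integral>x. g x * of_real x ^ k / fact k \<partial>\<mu>) * h ^ k) sums (\<integral>x. g x * exp (h * of_real x) \<partial>\<mu>)"
proof -
  define F where "F k x = g x * (h * of_real x) ^ k / fact k" for k x
  have nF: "norm (F k x) = norm (g x) * ((norm h * \<bar>x\<bar>) ^ k / fact k)" for k x
    by (simp add: F_def norm_mult norm_power norm_divide)
  have exp_sums: "(\<lambda>k. (norm h * \<bar>x\<bar>) ^ k / fact k) sums exp (norm h * \<bar>x\<bar>)" for x
    using exp_converges[of "norm h * \<bar>x\<bar>"] by (simp add: divide_inverse mult_ac)
  have sum_le: "(\<Sum>k<n. norm (F k x)) \<le> norm (g x) * exp (norm h * \<bar>x\<bar>)" for n x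
    unfolding nF sum_distrib_left[symmetric] sums_unique[OF exp_sums]
    by (intro mult_left_mono sum_le_suminf sums_summable[OF exp_sums]) auto
  have meas [measurable]: "F k \<in> borel_measurable \<mu>" for k
    unfolding F_def by measurable
  have intF: "integrable \<mu> (F k)" for k
  proof (rule Bochner_Integration.integrable_bound[OF int])
    show "AE x in \<mu>. norm (F k x) \<le> norm (norm (g x) * exp (norm h * \<bar>x\<bar>))"
    proof (intro AE_I2)
      fix x
      have "norm (F k x) \<le> (\<Sum>j<Suc k. norm (F j x))"
        by (intro member_le_sum) auto
      also note sum_le
      finally show "norm (F k x) \<le> norm (norm (g x) * exp (norm h * \<bar>x\<bar>))"
        by simp
    qed
  qed simp
  have "(\<lambda>k. integral\<^sup>L \<mu> (F k)) sums (\<integral>x. (\<Sum>k. F k x) \<partial>\<mu>)"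
  proof (rule sums_integral[OF intF])
    show "AE x in \<mu>. summable (\<lambda>k. norm (F k x))"
      unfolding nF by (intro AE_I2 summable_mult sums_summable[OF exp_sums])
    show "summable (\<lambda>k. \<integral>x. norm (F k x) \<partial>\<mu>)"
    proof (rule bounded_imp_summable)
      fix n
      have "(\<Sum>k\<le>n. \<integral>x. norm (F k x) \<partial>\<mu>) = (\<integral>x. (\<Sum>k<Suc n. norm (F k x)) \<partial>\<mu>)"
        using intF by (subst Bochner_Integration.integral_sum) (auto simp: lessThan_Suc_atMost)
      also have "\<dots> \<le> (\<integral>x. norm (g x) * exp (norm h * \<bar>x\<bar>) \<partial>\<mu>)"
        using intF by (intro integral_mono int sum_le Bochner_Integration.integrable_sum) auto
      finally show "(\<Sum>k\<le>n. \<integral>x. norm (F k x) \<partial>\<mu>) \<le> (\<integral>x. norm (g x) * exp (norm h * \<bar>x\<bar>) \<partial>\<mu>)" .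
    qed simp
  qed
  moreover have "(\<Sum>k. F k x) = g x * exp (h * of_real x)" for x
  proof -
    have "(\<lambda>k. (h * of_real x) ^ k / fact k) sums exp (h * of_real x)"
      using exp_converges[of "h * of_real x"] by (simp add: scaleR_conv_of_real divide_inverse mult_ac)
    from sums_mult[OF this, of "g x"] show ?thesis
      by (simp add: sums_iff F_def)
  qed
  moreover have "integral\<^sup>L \<mu> (F k) = (\<integral>x. g x * of_real x ^ k / fact k \<partial>\<mu>) * h ^ k" for k
    unfolding integral_mult_left_zero[symmetric] F_def
    by (simp add: power_mult_distrib mult_ac)
  ultimately show ?thesis by simp
qed

lemma laplace_transform_has_fps_expansion:
  fixes g :: "real \<Rightarrow> 'a::{banach, real_normed_field, second_countable_topology}"
  assumes "sets \<mu> = sets borel" "g \<in> borel_measurable borel" "0 < \<rho>"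
    and int: "\<And>t. t < \<rho> \<Longrightarrow> integrable \<mu> (\<lambda>x. norm (g x) * exp (t * \<bar>x\<bar>))"
  shows "(\<lambda>h. \<integral>x. g x * exp (h * of_real x) \<partial>\<mu>) has_fps_expansion
           Abs_fps (\<lambda>k. \<integral>x. g x * of_real x ^ k / fact k \<partial>\<mu>)"
proof (rule has_fps_expansionI)
  have "eventually (\<lambda>h::'a. h \<in> ball 0 \<rho>) (nhds 0)"
    using \<open>0 < \<rho>\<close> by (intro eventually_nhds_in_open) auto
  thus "eventually (\<lambda>h. (\<lambda>k. fps_nth (Abs_fps (\<lambda>k. \<integral>x. g x * of_real x ^ k / fact k \<partial>\<mu>)) k * h ^ k) sums
          (\<integral>x. g x * exp (h * of_real x) \<partial>\<mu>)) (nhds 0)"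
    unfolding fps_nth_Abs_fps
    by eventually_elim (rule laplace_transform_sums, use assms in auto)
qed

text \<open>Around each point \<open>s\<close> of the strip, \<open>exp (s * x)\<close> is absorbed
  into the weight \<open>g\<close> and the transform is expanded in the increment; the distance from
  \<open>s\<close> to the boundary of the strip serves as the radius.\<close>

lemma laplace_transform_holomorphic:
  assumes "exp_integrable_on \<mu> \<epsilon>"
  shows "(\<lambda>s. \<integral>x. exp (s * complex_of_real x) \<partial>\<mu>) holomorphic_on {s. \<bar>Re s\<bar> < \<epsilon>}"
proof (rule analytic_imp_holomorphic, subst analytic_on_analytic_at, safe)
  fix s assume s: "\<bar>Re s\<bar> < \<epsilon>"
  have [measurable_cong]: "sets \<mu> = sets borel"
    using assms by (simp add: exp_integrable_on_def)
  have "(\<lambda>h. \<integral>x. exp (s * complex_of_real x) * exp (h * of_real x) \<partial>\<mu>) has_fps_expansion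
         Abs_fps (\<lambda>k. \<integral>x. exp (s * complex_of_real x) * of_real x ^ k / fact k \<partial>\<mu>)"
  proof (rule laplace_transform_has_fps_expansion)
    show "0 < \<epsilon> - \<bar>Re s\<bar>" using s by simp
    fix t assume t: "t < \<epsilon> - \<bar>Re s\<bar>"
    show "integrable \<mu> (\<lambda>x. norm (exp (s * complex_of_real x)) * exp (t * \<bar>x\<bar>))"
    proof (rule Bochner_Integration.integrable_bound)
      show "integrable \<mu> (\<lambda>x. poly 1 x * exp ((t + \<bar>Re s\<bar>) * \<bar>x\<bar>))"
        using s t by (intro exp_integrable_on_poly[OF assms]) auto
      have "Re s * x \<le> \<bar>Re s\<bar> * \<bar>x\<bar>" for x
        by (metis abs_mult abs_ge_self)
      thus "AE x in \<mu>. norm (norm (exp (s * complex_of_real x)) * exp (t * \<bar>x\<bar>)) \<le>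
              norm (poly 1 x * exp ((t + \<bar>Re s\<bar>) * \<bar>x\<bar>))"
        by (intro AE_I2) (auto simp: norm_exp_eq_Re exp_add[symmetric] algebra_simps)
    qed measurable
  qed (use assms in \<open>auto simp: exp_integrable_on_def\<close>)
  thus "(\<lambda>s. \<integral>x. exp (s * complex_of_real x) \<partial>\<mu>) analytic_on {s}"
    by (intro has_fps_expansion_imp_analytic) (simp add: exp_add ring_distribs)
qed

text \<open>The difference of the two transforms is holomorphic on a strip that contains the
  imaginary axis, where it is the difference of the characteristic functions. Mere accumulation at 0
  is assumed, because agreement will be known only along the values of a generator.\<close>

lemma laplace_transform_identity:
  assumes \<mu>: "exp_integrable_on \<mu> \<epsilon>" and \<nu>: "exp_integrable_on \<nu> \<epsilon>"
    and "0 < \<epsilon>" and "0 islimpt {t. mgf \<mu> t = mgf \<nu> t}"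
    and dist: "real_distribution \<mu>" "real_distribution \<nu>"
  shows "\<mu> = \<nu>"
proof (rule Levy_uniqueness[OF dist], rule ext)
  fix t :: real
  define S where "S = {s. \<bar>Re s\<bar> < \<epsilon>}"
  define D where "D s = (\<integral>x. exp (s * complex_of_real x) \<partial>\<mu>) - (\<integral>x. exp (s * complex_of_real x) \<partial>\<nu>)" for s
  define U where "U = complex_of_real ` ({t. mgf \<mu> t = mgf \<nu> t} \<inter> {-\<epsilon><..<\<epsilon>})"
  have S_eq: "S = {s. Re s < \<epsilon>} \<inter> {s. Re s > -\<epsilon>}"
    by (auto simp: S_def)
  have "D (\<i> * of_real t) = 0"
  proof (rule analytic_continuation[where f = D and S = S and U = U and \<xi> = 0])
    show "D holomorphic_on S"
      unfolding D_def S_def by (intro holomorphic_on_diff laplace_transform_holomorphic \<mu> \<nu>)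
    show "open S"
      unfolding S_eq by (intro open_Int open_halfspace_Re_lt open_halfspace_Re_gt)
    show "connected S"
      unfolding S_eq by (intro convex_connected convex_Int convex_halfspace_Re_lt convex_halfspace_Re_gt)
    show "U \<subseteq> S" by (auto simp: U_def S_def)
    show "0 \<in> S" "\<i> * of_real t \<in> S" using \<open>0 < \<epsilon>\<close> by (auto simp: S_def)
    show "0 islimpt U"
      unfolding islimpt_approachable
    proof safe
      fix e :: real assume "0 < e"
      \<comment> \<open>The bound \<epsilon> in the minimum is what puts the point into the strip,
        hence into \<open>U\<close>.\<close>
      with assms(3,4) obtain s where "mgf \<mu> s = mgf \<nu> s" "s \<noteq> 0" "dist s 0 < min e \<epsilon>"
        unfolding islimpt_approachable by (metis (mono_tags) mem_Collect_eq min_less_iff_conj)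
      thus "\<exists>x'\<in>U. x' \<noteq> 0 \<and> dist x' 0 < e"
        by (intro bexI[of _ "of_real s"]) (auto simp: U_def intro!: imageI)
    qed
    show "D z = 0" if "z \<in> U" for z
      using that by (auto simp: U_def D_def mgf_def exp_of_real simp flip: of_real_mult)
  qed
  thus "char \<mu> t = char \<nu> t"
    by (simp add: char_def D_def mult_ac)
qed

section \<open>Power series expansions of real functions\<close>

text \<open>If the series first differ at order n, dividing f - f by \<open>x ^ n\<close> gives a
  function that is 0 away from 0, yet continuous at 0 with the nonzero value
  \<open>c\<close>.\<close>

lemma has_fps_expansion_unique:
  fixes F G :: "'a :: {banach, real_normed_field} fps"
  assumes "f has_fps_expansion F" "f has_fps_expansion G"
  shows "F = G"
proof (rule ccontr)
  define n c where "n = subdegree (F - G)" and "c = fps_nth (F - G) n"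
  assume "F \<noteq> G"
  hence "c \<noteq> 0"
    unfolding c_def n_def by (intro nth_subdegree_nonzero) simp
  have "(\<lambda>x. if x = 0 then c else (f x - f x) / x ^ n) has_fps_expansion fps_shift n (F - G)"
    by (intro has_fps_expansion_shift has_fps_expansion_diff assms) (auto simp: n_def c_def)
  from has_fps_expansion_imp_continuous[OF this, of UNIV]
  have "((\<lambda>x::'a. if x = 0 then c else 0) \<longlongrightarrow> c) (at 0)"
    by (simp add: continuous_within cong: if_cong)
  moreover have "((\<lambda>x::'a. if x = 0 then c else 0) \<longlongrightarrow> 0) (at 0)"
    by (rule Lim_transform_eventually[OF tendsto_const]) (auto simp: eventually_at_filter)
  ultimately show False
    using \<open>c \<noteq> 0\<close> tendsto_unique[of "at (0::'a)"] by force
qed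

definition fps_of_real :: "real fps \<Rightarrow> complex fps" where
  "fps_of_real F = Abs_fps (\<lambda>n. of_real (fps_nth F n))"

lemma fps_of_real_nth [simp]: "fps_nth (fps_of_real F) n = of_real (fps_nth F n)"
  by (simp add: fps_of_real_def)

lemma fps_of_real_power: "fps_of_real (F ^ n) = fps_of_real F ^ n"
proof (induction n)
  case 0
  show ?case by (simp add: fps_eq_iff)
next
  case (Suc n)
  have "fps_of_real (F * F ^ n) = fps_of_real F * fps_of_real (F ^ n)"
    by (simp add: fps_eq_iff fps_mult_nth)
  thus ?case by (simp add: Suc)
qed

lemma fps_of_real_compose: "fps_of_real (F oo G) = fps_of_real F oo fps_of_real G"
  by (simp add: fps_eq_iff fps_compose_nth flip: fps_of_real_power)

lemma fps_conv_radius_of_real [simp]: "fps_conv_radius (fps_of_real F) = fps_conv_radius F"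
  by (simp add: fps_conv_radius_def conv_radius_def)

lemma eval_fps_of_real:
  assumes "x \<in> eball 0 (fps_conv_radius F)"
  shows "eval_fps (fps_of_real F) (of_real x) = of_real (eval_fps F x)"
proof -
  have "summable (\<lambda>n. fps_nth F n * x ^ n)"
    using assms by (intro summable_fps) (auto simp: eball_def)
  thus ?thesis
    by (simp add: eval_fps_def suminf_of_real)
qed

text \<open>Embedding the coefficients into the complex numbers preserves the radius of convergence
  and the values at real points, so real expansions are exactly the restrictions of complex ones
  with real coefficients.\<close>

lemma has_fps_expansion_of_real_iff:
  "f has_fps_expansion F \<longleftrightarrow>
     (\<exists>g. g has_fps_expansion fps_of_real F \<and> (\<forall>\<^sub>F x in nhds 0. g (of_real x) = of_real (f x)))"
proof safe
  assume f: "f has_fps_expansion F"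
  have "eventually (\<lambda>x. x \<in> eball 0 (fps_conv_radius F)) (nhds 0)"
    using f by (intro eventually_nhds_in_open) (auto simp: has_fps_expansion_def zero_ereal_def)
  moreover have "\<forall>\<^sub>F x in nhds 0. eval_fps F x = f x"
    using f by (simp add: has_fps_expansion_def)
  ultimately have "\<forall>\<^sub>F x in nhds 0. eval_fps (fps_of_real F) (of_real x) = of_real (f x)"
    by eventually_elim (simp add: eval_fps_of_real)
  moreover have "eval_fps (fps_of_real F) has_fps_expansion fps_of_real F"
    using f by (intro eval_fps_has_fps_expansion) (simp add: has_fps_expansion_def)
  ultimately show "\<exists>g. g has_fps_expansion fps_of_real F \<and> (\<forall>\<^sub>F x in nhds 0. g (of_real x) = of_real (f x))"
    by blast
next
  fix g assume g: "g has_fps_expansion fps_of_real F" "\<forall>\<^sub>F x in nhds 0. g (of_real x) = of_real (f x)"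
  hence r: "fps_conv_radius F > 0"
    by (simp add: has_fps_expansion_def)
  have "filterlim complex_of_real (nhds 0) (nhds 0)"
    using tendsto_of_real[OF filterlim_ident[of "nhds (0::real)"], where 'a = complex] by simp
  moreover have "\<forall>\<^sub>F z in nhds 0. eval_fps (fps_of_real F) z = g z"
    using g(1) by (simp add: has_fps_expansion_def)
  ultimately have "\<forall>\<^sub>F x in nhds 0. eval_fps (fps_of_real F) (of_real x) = g (of_real x)"
    by (rule eventually_compose_filterlim[rotated])
  moreover have "eventually (\<lambda>x. x \<in> eball 0 (fps_conv_radius F)) (nhds 0)"
    using r by (intro eventually_nhds_in_open) (auto simp: zero_ereal_def)
  ultimately have "\<forall>\<^sub>F x in nhds 0. eval_fps F x = f x"
    using g(2) by eventually_elim (simp add: eval_fps_of_real)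
  with r show "f has_fps_expansion F"
    by (simp add: has_fps_expansion_def)
qed

text \<open>The library has composition of expansions for complex functions only.\<close>

lemma has_fps_expansion_compose_real:
  fixes f g :: "real \<Rightarrow> real"
  assumes f: "f has_fps_expansion F" and g: "g has_fps_expansion G" and "fps_nth G 0 = 0"
  shows "(\<lambda>x. f (g x)) has_fps_expansion (F oo G)"
proof -
  obtain f' where f': "f' has_fps_expansion fps_of_real F" "\<forall>\<^sub>F x in nhds 0. f' (of_real x) = of_real (f x)"
    using f unfolding has_fps_expansion_of_real_iff by blast
  obtain g' where g': "g' has_fps_expansion fps_of_real G" "\<forall>\<^sub>F x in nhds 0. g' (of_real x) = of_real (g x)"
    using g unfolding has_fps_expansion_of_real_iff by blast
  have "g 0 = 0"
    using has_fps_expansion_imp_0_eq_fps_nth_0[OF g] assms(3) by simp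
  \<comment> \<open>The relation between \<open>f'\<close> and \<open>f\<close> holds only near 0;
    continuity of \<open>g\<close> at 0 lets it be used at the points \<open>g x\<close>.\<close>
  hence "filterlim g (nhds 0) (nhds 0)"
    using has_fps_expansion_imp_continuous[OF g, of UNIV]
    by (metis tendsto_at_iff_tendsto_nhds isCont_def)
  with f'(2) have "\<forall>\<^sub>F x in nhds 0. f' (of_real (g x)) = of_real (f (g x))"
    by (rule eventually_compose_filterlim)
  with g'(2) have "\<forall>\<^sub>F x in nhds 0. (f' \<circ> g') (of_real x) = of_real (f (g x))"
    by eventually_elim simp
  moreover have "(f' \<circ> g') has_fps_expansion fps_of_real (F oo G)"
    unfolding fps_of_real_compose
    by (rule has_fps_expansion_compose[OF f'(1) g'(1)]) (simp add: assms)
  ultimately show ?thesis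
    unfolding has_fps_expansion_of_real_iff by blast
qed

section \<open>Meixner polynomials\<close>

lemma meixner_polys_unique:
  assumes "meixner_polys u \<mu> P" "meixner_polys u \<mu> Q"
  shows "P = Q"
proof (intro ext poly_ext)
  fix n x
  have "Abs_fps (\<lambda>n. poly (P n) x / fact n) = Abs_fps (\<lambda>n. poly (Q n) x / fact n)"
    by (rule has_fps_expansion_unique) (use assms in \<open>auto simp: meixner_polys_def\<close>)
  thus "poly (P n) x = poly (Q n) x"
    by (auto simp: fps_eq_iff)
qed

text \<open>Membership in the class provides only some orthogonal sequence with the generating
  function; uniqueness identifies it with the given one.\<close>

lemma meixner_orthogonal:
  assumes "\<mu> \<in> meixner_class u" "meixner_polys u \<mu> P"
  shows "(\<integral>x. poly (P m) x * poly (P n) x \<partial>\<mu>) = (if m = n then sq_norm \<mu> (P n) else 0)"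
proof -
  obtain Q where "meixner_polys u \<mu> Q" "\<forall>m n. m \<noteq> n \<longrightarrow> (\<integral>x. poly (Q m) x * poly (Q n) x \<partial>\<mu>) = 0"
    using assms(1) by (auto simp: meixner_class_def)
  with meixner_polys_unique[OF assms(2) this(1)] show ?thesis
    by (auto simp: sq_norm_def power2_eq_square)
qed

lemma mgf_finite_near_0_iff:
  assumes "sets \<mu> = sets borel"
  shows "mgf_finite_near_0 \<mu> \<longleftrightarrow> (\<exists>\<epsilon>>0. exp_integrable_on \<mu> \<epsilon>)"
proof
  assume "mgf_finite_near_0 \<mu>"
  then obtain a b where "a < 0" "0 < b" "\<forall>t\<in>{a<..<b}. integrable \<mu> (\<lambda>x. exp (t * x))"
    by (auto simp: mgf_finite_near_0_def)
  thus "\<exists>\<epsilon>>0. exp_integrable_on \<mu> \<epsilon>"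
    using assms by (intro exI[of _ "min (-a) b"]) (auto simp: exp_integrable_on_def abs_less_iff)
next
  assume "\<exists>\<epsilon>>0. exp_integrable_on \<mu> \<epsilon>"
  then obtain \<epsilon> where "\<epsilon> > 0" "exp_integrable_on \<mu> \<epsilon>"
    by blast
  thus "mgf_finite_near_0 \<mu>"
    unfolding mgf_finite_near_0_def exp_integrable_on_def
    by (intro exI[of _ "-\<epsilon>"] exI[of _ \<epsilon>]) auto
qed

lemma laplace_transform_poly_has_fps_expansion:
  assumes "exp_integrable_on \<mu> \<epsilon>" "0 < \<epsilon>"
  shows "(\<lambda>t. \<integral>x. poly p x * exp (t * x) \<partial>\<mu>) has_fps_expansion
           Abs_fps (\<lambda>k. \<integral>x. poly p x * x ^ k / fact k \<partial>\<mu>)"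
proof -
  have "integrable \<mu> (\<lambda>x. norm (poly p x) * exp (t * \<bar>x\<bar>))" if "t < \<epsilon>" for t
    using integrable_norm[OF exp_integrable_on_poly[OF assms(1) that assms(2), of p]]
    by (simp add: abs_mult)
  from laplace_transform_has_fps_expansion[OF _ _ assms(2) this] assms show ?thesis
    by (simp add: exp_integrable_on_def)
qed

lemma mgf_has_fps_expansion:
  assumes "exp_integrable_on \<mu> \<epsilon>" "0 < \<epsilon>"
  shows "mgf \<mu> has_fps_expansion Abs_fps (\<lambda>k. \<integral>x. x ^ k / fact k \<partial>\<mu>)"
  using laplace_transform_poly_has_fps_expansion[OF assms, of 1] by (simp add: mgf_def[abs_def])

text \<open>Integrating the generating function against \<open>P n\<close> leaves only the term of
  index n. Its expansion in z holds near 0 with a radius that may depend on x, so the interchange of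
  sum and integral is done on coefficients, where all sums are finite.\<close>

lemma meixner_laplace_transform:
  assumes u: "meixner_generator u" and \<mu>: "\<mu> \<in> meixner_class u" and P: "meixner_polys u \<mu> P"
  shows "\<forall>\<^sub>F z in nhds 0. (\<integral>x. poly (P n) x * exp (u z * x) \<partial>\<mu>) =
           mgf \<mu> (u z) * (sq_norm \<mu> (P n) / fact n * z ^ n)"
proof -
  interpret real_distribution \<mu>
    using \<mu> by (simp add: meixner_class_def)
  obtain U where U: "u has_fps_expansion U" and "u 0 = 0"
    using u by (auto simp: meixner_generator_def)
  hence U0: "fps_nth U 0 = 0"
    using has_fps_expansion_imp_0_eq_fps_nth_0 by metis
  obtain \<epsilon> where \<epsilon>: "exp_integrable_on \<mu> \<epsilon>" "0 < \<epsilon>"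
    using \<mu> mgf_finite_near_0_iff[OF events_eq_borel] by (auto simp: meixner_class_def)
  \<comment> \<open>\<open>B\<close> expands the transform of \<open>P n\<close> and
    \<open>M\<close> expands the moment generating function, so \<open>(B oo U) * G\<close> is the
    expansion in z of their quotient at \<open>u z\<close>.\<close>
  define B where "B = Abs_fps (\<lambda>k. \<integral>x. poly (P n) x * x ^ k / fact k \<partial>\<mu>)"
  define M where "M = Abs_fps (\<lambda>k. \<integral>x. x ^ k / fact k \<partial>\<mu>)"
  define G where "G = inverse (M oo U)"
  \<comment> \<open>The constant coefficient is the total mass 1, so \<open>M oo U\<close> is
    invertible.\<close>
  have M0: "fps_nth (M oo U) 0 \<noteq> 0"
    using prob_space by (simp add: M_def)
  have mgf: "(\<lambda>z. mgf \<mu> (u z)) has_fps_expansion (M oo U)"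
    unfolding M_def by (intro has_fps_expansion_compose_real mgf_has_fps_expansion[OF \<epsilon>] U U0)
  have P_eq: "Abs_fps (\<lambda>k. poly (P k) x / fact k) = (fps_exp x oo U) * G" for x
  proof (rule has_fps_expansion_unique)
    show "(\<lambda>z. exp (x * u z) / mgf \<mu> (u z)) has_fps_expansion Abs_fps (\<lambda>k. poly (P k) x / fact k)"
      using P by (simp add: meixner_polys_def)
    have "(\<lambda>z. exp (x * u z) / mgf \<mu> (u z)) has_fps_expansion ((fps_exp x oo U) / (M oo U))"
      by (intro has_fps_expansion_divide' mgf M0 has_fps_expansion_compose_real[OF _ U U0] has_fps_expansion_exp)
    thus "(\<lambda>z. exp (x * u z) / mgf \<mu> (u z)) has_fps_expansion ((fps_exp x oo U) * G)"
      using M0 by (simp add: fps_divide_unit G_def)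
  qed
  have int: "integrable \<mu> (\<lambda>x. poly (P n) x * x ^ j)" for j
    using exp_integrable_on_poly_exp[OF \<epsilon>(1), of 0 "P n * monom 1 j"] \<epsilon>(2)
    by (simp add: poly_monom)
  \<comment> \<open>\<open>P k\<close> is a combination of powers of \<open>x\<close> with coefficients read off \<open>U\<close> and \<open>G\<close>, so integrating
    against \<open>P n\<close> and using orthogonality identifies \<open>(B oo U) * G\<close> purely formally.\<close>
  have BG: "(B oo U) * G = fps_const (sq_norm \<mu> (P n) / fact n) * fps_X ^ n"
  proof (rule fps_ext)
    fix k
    have "fps_nth ((B oo U) * G) k =
        (\<Sum>i=0..k. (\<Sum>j=0..i. (\<integral>x. poly (P n) x * x ^ j / fact j \<partial>\<mu>) * fps_nth (U ^ j) i) * fps_nth G (k - i))"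
      by (simp add: fps_mult_nth fps_compose_nth B_def)
    also have "\<dots> = (\<integral>x. (\<Sum>i=0..k. (\<Sum>j=0..i. poly (P n) x * x ^ j / fact j * fps_nth (U ^ j) i) * fps_nth G (k - i)) \<partial>\<mu>)"
      using int by (simp add: Bochner_Integration.integral_sum Bochner_Integration.integrable_sum)
    also have "\<dots> = (\<integral>x. poly (P n) x * fps_nth ((fps_exp x oo U) * G) k \<partial>\<mu>)"
      unfolding fps_mult_nth fps_compose_nth fps_exp_nth
      by (intro Bochner_Integration.integral_cong) (simp_all add: sum_distrib_left sum_distrib_right mult_ac)
    also have "\<dots> = (\<integral>x. poly (P n) x * poly (P k) x \<partial>\<mu>) / fact k"
      by (simp flip: P_eq)
    also have "\<dots> = fps_nth (fps_const (sq_norm \<mu> (P n) / fact n) * fps_X ^ n) k"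
      by (simp add: meixner_orthogonal[OF \<mu> P])
    finally show "fps_nth ((B oo U) * G) k = fps_nth (fps_const (sq_norm \<mu> (P n) / fact n) * fps_X ^ n) k" .
  qed
  have B_eq: "B oo U = (M oo U) * (fps_const (sq_norm \<mu> (P n) / fact n) * fps_X ^ n)"
    using M0 unfolding BG[symmetric] G_def by (simp add: mult.left_commute inverse_mult_eq_1')
  have "(\<lambda>z. \<integral>x. poly (P n) x * exp (u z * x) \<partial>\<mu>) has_fps_expansion (B oo U)"
    unfolding B_def
    by (rule has_fps_expansion_compose_real[OF laplace_transform_poly_has_fps_expansion[OF \<epsilon>] U U0])
  moreover have "(\<lambda>z. mgf \<mu> (u z) * (sq_norm \<mu> (P n) / fact n * z ^ n)) has_fps_expansion (B oo U)"
    unfolding B_eq by (intro has_fps_expansion_mult has_fps_expansion_const has_fps_expansion_fps_X_power mgf)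
  ultimately have "(\<lambda>z. (\<integral>x. poly (P n) x * exp (u z * x) \<partial>\<mu>) -
      mgf \<mu> (u z) * (sq_norm \<mu> (P n) / fact n * z ^ n)) has_fps_expansion (B oo U) - (B oo U)"
    by (rule has_fps_expansion_diff)
  thus ?thesis
    by (simp add: has_fps_expansion_0_iff)
qed

lemma mgf_pos:
  assumes "prob_space \<mu>" "integrable \<mu> (\<lambda>x. exp (t * x))"
  shows "mgf \<mu> t > 0"
proof -
  interpret prob_space \<mu> by fact
  have "mgf \<mu> t \<noteq> 0"
    using assms(2) AE_False by (simp add: mgf_def integral_nonneg_eq_0_iff_AE)
  moreover have "mgf \<mu> t \<ge> 0"
    unfolding mgf_def by (intro Bochner_Integration.integral_nonneg) simp
  ultimately show ?thesis by simp
qed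

text \<open>The difference quotient at 0 tends to 1. This guarantees that the values of a generator
  really accumulate at 0 instead of being constantly 0 nearby.\<close>

lemma meixner_generator_eventually_nonzero:
  assumes "meixner_generator u"
  shows "\<forall>\<^sub>F z in at 0. u z \<noteq> 0"
proof -
  have "((\<lambda>z. (u z - u 0) / (z - 0)) \<longlongrightarrow> 1) (at 0)"
    using assms by (auto simp: meixner_generator_def has_field_derivative_iff)
  hence "\<forall>\<^sub>F z in at 0. (u z - u 0) / (z - 0) \<noteq> 0"
    by (rule tendsto_imp_eventually_ne) simp
  thus ?thesis
    by eventually_elim (use assms in \<open>auto simp: meixner_generator_def\<close>)
qed

lemma meixner_generator_tendsto:
  assumes "meixner_generator u"
  shows "filterlim u (nhds 0) (nhds 0)"
proof -
  have "isCont u 0"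
    using assms unfolding meixner_generator_def by (blast intro: DERIV_isCont)
  thus ?thesis
    using assms by (metis tendsto_at_iff_tendsto_nhds isCont_def meixner_generator_def)
qed

text \<open>Integrability passes to smaller radii, so it holds for all sufficiently small ones; in
  this form it is closed under finite conjunctions.\<close>

lemma exp_integrable_on_uniform:
  assumes "finite I" "\<And>i. i \<in> I \<Longrightarrow> \<mu> i \<in> meixner_class u"
  shows "\<forall>\<^sub>F \<epsilon> in at_right 0. \<forall>i\<in>I. exp_integrable_on (\<mu> i) \<epsilon>"
proof (rule eventually_ball_finite[OF assms(1)], rule ballI)
  fix i assume "i \<in> I"
  hence "sets (\<mu> i) = sets borel" "mgf_finite_near_0 (\<mu> i)"
    using assms(2) by (auto simp: meixner_class_def real_distribution_def real_distribution_axioms_def)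
  then obtain e where e: "e > 0" "exp_integrable_on (\<mu> i) e"
    using mgf_finite_near_0_iff by blast
  thus "\<forall>\<^sub>F \<epsilon> in at_right 0. exp_integrable_on (\<mu> i) \<epsilon>"
    unfolding eventually_at_right_field by (intro exI[of _ e]) (auto simp: exp_integrable_on_def)
qed

section \<open>Product densities\<close>

text \<open>Each integral against \<open>\<mu> i\<close> becomes an integral of
  \<open>\<phi> i * g i\<close> over the reference measure, and Fubini then factors the integral of
  the product.\<close>

lemma product_density_integral:
  fixes g :: "'i \<Rightarrow> real \<Rightarrow> real"
  assumes "sigma_finite_measure L" "finite I"
    and dens: "\<And>i. i \<in> I \<Longrightarrow> is_density_of L (\<phi> i) (\<mu> i)"
    and int: "\<And>i. i \<in> I \<Longrightarrow> integrable (\<mu> i) (g i)"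
  shows "integrable (Pi\<^sub>M I (\<lambda>_. L)) (\<lambda>x. (\<Prod>i\<in>I. \<phi> i (x i)) * (\<Prod>i\<in>I. g i (x i)))" (is ?A)
    and "(\<integral>x. (\<Prod>i\<in>I. \<phi> i (x i)) * (\<Prod>i\<in>I. g i (x i)) \<partial>Pi\<^sub>M I (\<lambda>_. L)) = (\<Prod>i\<in>I. \<integral>x. g i x \<partial>\<mu> i)" (is ?B)
proof -
  interpret product_sigma_finite "\<lambda>_ :: 'i. L"
    using assms(1) by (simp add: product_sigma_finite_def)
  have 1: "integrable L (\<lambda>x. \<phi> i x * g i x) \<and> (\<integral>x. g i x \<partial>\<mu> i) = (\<integral>x. \<phi> i x * g i x \<partial>L)" if i: "i \<in> I" for i
  proof -
    have \<phi>: "\<phi> i \<in> borel_measurable L" "AE x in L. 0 \<le> \<phi> i x" "\<mu> i = density L (\<lambda>x. ennreal (\<phi> i x))"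
      using dens[OF i] by (auto simp: is_density_of_def prob_density_def)
    moreover from this have "g i \<in> borel_measurable L"
      using borel_measurable_integrable[OF int[OF i]] by simp
    ultimately show ?thesis
      using int[OF i] by (simp add: integrable_real_density integral_real_density)
  qed
  show ?A ?B
    using product_integrable_prod[OF assms(2), of "\<lambda>i x. \<phi> i x * g i x"]
      product_integral_prod[OF assms(2), of "\<lambda>i x. \<phi> i x * g i x"] 1
    by (simp_all add: prod.distrib)
qed

text \<open>Each density is nonnegative only almost everywhere. The exceptional set for coordinate i
  lies in a box whose i-th side is null.\<close>

lemma AE_PiM_prod_nonneg:
  fixes \<phi> :: "'i \<Rightarrow> 'a \<Rightarrow> real"
  assumes "sigma_finite_measure L" "finite I"
    and meas: "\<And>i. i \<in> I \<Longrightarrow> \<phi> i \<in> borel_measurable L"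
    and nonneg: "\<And>i. i \<in> I \<Longrightarrow> AE x in L. 0 \<le> \<phi> i x"
  shows "AE x in Pi\<^sub>M I (\<lambda>_. L). 0 \<le> (\<Prod>i\<in>I. \<phi> i (x i))"
proof -
  interpret product_sigma_finite "\<lambda>_ :: 'i. L"
    using assms(1) by (simp add: product_sigma_finite_def)
  have "AE x in Pi\<^sub>M I (\<lambda>_. L). \<forall>i\<in>I. 0 \<le> \<phi> i (x i)"
    unfolding AE_finite_all[OF assms(2)]
  proof
    fix i assume i: "i \<in> I"
    define A where "A j = (if j = i then {x \<in> space L. \<phi> i x < 0} else space L)" for j
    have A: "A j \<in> sets L" for j
      using meas[OF i] by (auto simp: A_def)
    have "{x \<in> space L. \<not> 0 \<le> \<phi> i x} \<in> null_sets L"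
      using nonneg[OF i] meas[OF i] by (subst (asm) AE_iff_null) auto
    hence "emeasure L (A i) = 0"
      by (simp add: A_def not_le null_sets_def)
    \<comment> \<open>The other sides may have infinite measure, but 0 times infinity is 0 in
      \<open>ennreal\<close>.\<close>
    hence "emeasure (Pi\<^sub>M I (\<lambda>_. L)) (Pi\<^sub>E I A) = 0"
      using i assms(2) A by (auto simp: emeasure_PiM prod_zero_iff)
    moreover have "Pi\<^sub>E I A \<in> sets (Pi\<^sub>M I (\<lambda>_. L))"
      using A assms(2) by (intro sets_PiM_I_finite) auto
    ultimately have "Pi\<^sub>E I A \<in> null_sets (Pi\<^sub>M I (\<lambda>_. L))"
      by (simp add: null_sets_def)
    moreover have "{x \<in> space (Pi\<^sub>M I (\<lambda>_. L)). \<not> 0 \<le> \<phi> i (x i)} \<subseteq> Pi\<^sub>E I A"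
      by (auto simp: A_def space_PiM PiE_iff extensional_def)
    ultimately show "AE x in Pi\<^sub>M I (\<lambda>_. L). 0 \<le> \<phi> i (x i)"
      by (rule AE_I')
  qed
  thus ?thesis
    by eventually_elim (auto intro!: prod_nonneg)
qed

text \<open>The law of \<open>S (Z \<omega>)\<close> is the image under \<open>S\<close> of the
  measure with density \<open>h\<close>. Nonnegativity almost everywhere allows the passage from the
  \<open>ennreal\<close> density to the real integrand.\<close>

lemma distributed_transform_integral:
  fixes g :: "real \<Rightarrow> real"
  assumes dist: "distributed \<Omega> M Z (\<lambda>x. ennreal (h x))"
    and h: "h \<in> borel_measurable M" "AE x in M. 0 \<le> h x"
    and S [measurable]: "S \<in> borel_measurable M" and g [measurable]: "g \<in> borel_measurable borel"
  shows "integrable (distr \<Omega> borel (\<lambda>\<omega>. S (Z \<omega>))) g \<longleftrightarrow> integrable M (\<lambda>x. h x * g (S x))" (is ?A)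
    and "(\<integral>x. g x \<partial>distr \<Omega> borel (\<lambda>\<omega>. S (Z \<omega>))) = (\<integral>x. h x * g (S x) \<partial>M)" (is ?B)
proof -
  have Z [measurable]: "Z \<in> measurable \<Omega> M" and eq: "distr \<Omega> M Z = density M (\<lambda>x. ennreal (h x))"
    using dist by (auto simp: distributed_def)
  have "distr \<Omega> borel (\<lambda>\<omega>. S (Z \<omega>)) = distr (density M (\<lambda>x. ennreal (h x))) borel S"
    by (subst eq[symmetric], subst distr_distr) (simp_all add: comp_def)
  thus ?A ?B
    using h by (simp_all add: integrable_distr_eq integral_distr integrable_real_density integral_real_density)
qed

section \<open>Sums over multi-indices and the main result\<close>

lemma finite_multi_indices: "finite (multi_indices d {a..b})"
proof (rule finite_subset)
  show "multi_indices d {a..b} \<subseteq> ({1..d} \<rightarrow>\<^sub>E {..b})"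
  proof
    fix n assume n: "n \<in> multi_indices d {a..b}"
    have "n i \<le> b" if "i \<in> {1..d}" for i
      using member_le_sum[OF that, of n] n by (simp add: multi_indices_def)
    with n show "n \<in> {1..d} \<rightarrow>\<^sub>E {..b}"
      by (auto simp: multi_indices_def PiE_iff)
  qed
qed (auto intro: finite_PiE)

lemma sum_multi_indices_by_degree:
  fixes h :: "(nat \<Rightarrow> nat) \<Rightarrow> real"
  shows "(\<Sum>n\<in>multi_indices d {a..b}. h n) = (\<Sum>m=a..b. \<Sum>n\<in>multi_indices d {m}. h n)"
proof -
  have "(\<Sum>n\<in>multi_indices d {a..b}. h n) =
      (\<Sum>m=a..b. \<Sum>n\<in>{n \<in> multi_indices d {a..b}. (\<Sum>i=1..d. n i) = m}. h n)"
    by (rule sum.group[symmetric]) (auto simp: finite_multi_indices, auto simp: multi_indices_def)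
  also have "\<dots> = (\<Sum>m=a..b. \<Sum>n\<in>multi_indices d {m}. h n)"
    by (intro sum.cong) (auto simp: multi_indices_def)
  finally show ?thesis .
qed

lemma poly_eq_0_if_eventually_0:
  fixes p :: "real poly"
  assumes "\<forall>\<^sub>F z in nhds 0. poly p z = 0"
  shows "p = 0"
proof -
  have "poly p has_fps_expansion fps_of_poly p"
    using eval_fps_has_fps_expansion[of "fps_of_poly p"] by (simp add: eval_fps_of_poly[abs_def])
  moreover have "poly p has_fps_expansion 0"
    using assms by (simp add: has_fps_expansion_0_iff)
  ultimately show ?thesis
    using has_fps_expansion_unique by (metis fps_of_poly_0 fps_of_poly_eq_iff)
qed

theorem proposition3:
  fixes d N :: nat
    and L :: "real measure"
    and u u' :: "real \<Rightarrow> real"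
    and r r' :: "nat \<Rightarrow> real \<times> real"
    and \<mu> \<mu>' :: "nat \<Rightarrow> real measure"
    and \<phi> \<phi>' :: "nat \<Rightarrow> real \<Rightarrow> real"
    and P' :: "nat \<Rightarrow> nat \<Rightarrow> real poly"
    and \<kappa> :: real
    and H :: "(nat \<Rightarrow> nat) \<Rightarrow> real"
    and f :: "(nat \<Rightarrow> real) \<Rightarrow> real"
    and \<Omega>X :: "'a measure" and X :: "'a \<Rightarrow> nat \<Rightarrow> real"
    and \<Omega>Y :: "'b measure" and Y :: "'b \<Rightarrow> nat \<Rightarrow> real"
  assumes "d \<ge> 1" and "N \<ge> 1"
    and "sigma_finite_measure L" and "sets L = sets borel"
    and "meixner_generator u" and "meixner_generator u'"
    and "\<And>i. i \<in> {1..d} \<Longrightarrow> \<mu> i \<in> meixner_class u \<and> has_parameter (\<mu> i) (r i)"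
    and "\<And>i. i \<in> {1..d} \<Longrightarrow> is_density_of L (\<phi> i) (\<mu> i)"
    and "\<And>i. i \<in> {1..d} \<Longrightarrow> \<mu>' i \<in> meixner_class u' \<and> has_parameter (\<mu>' i) (r' i)"
    and "\<And>i. i \<in> {1..d} \<Longrightarrow> is_density_of L (\<phi>' i) (\<mu>' i)"
    and "\<And>i. i \<in> {1..d} \<Longrightarrow> meixner_polys u' (\<mu>' i) (P' i)"
    and "\<kappa> \<noteq> 0"
    and "f = (\<lambda>x. (\<Prod>i=1..d. \<phi> i (x i)) +
            \<kappa> * (\<Prod>i=1..d. \<phi>' i (x i)) *
              (\<Sum>n\<in>multi_indices d {1..N}. H n * (\<Prod>i=1..d. poly (P' i (n i)) (x i))))"
    and "prob_density (Pi\<^sub>M {1..d} (\<lambda>_. L)) f"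
    and "prob_space \<Omega>Y" and "distributed \<Omega>Y (Pi\<^sub>M {1..d} (\<lambda>_. L)) Y (\<lambda>x. ennreal (f x))"
    and "prob_space \<Omega>X"
    and "distributed \<Omega>X (Pi\<^sub>M {1..d} (\<lambda>_. L)) X (\<lambda>x. ennreal (\<Prod>i=1..d. \<phi> i (x i)))"
  shows "distr \<Omega>Y borel (\<lambda>\<omega>. \<Sum>i=1..d. Y \<omega> i) = distr \<Omega>X borel (\<lambda>\<omega>. \<Sum>i=1..d. X \<omega> i) \<longleftrightarrow>
         (\<forall>m\<in>{1..N}. (\<Sum>n\<in>multi_indices d {m}.
            H n * (1 / (\<Prod>i=1..d. fact (n i))) * (\<Prod>i=1..d. sq_norm (\<mu>' i) (P' i (n i)))) = 0)"
proof -
  note gen = \<open>meixner_generator u'\<close>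
  define I M where "I = {1..d}" and "M = Pi\<^sub>M I (\<lambda>_. L)"
  define S where "S x = (\<Sum>i\<in>I. x i)" for x :: "nat \<Rightarrow> real"
  define \<nu>X \<nu>Y where "\<nu>X = distr \<Omega>X borel (\<lambda>\<omega>. S (X \<omega>))" and "\<nu>Y = distr \<Omega>Y borel (\<lambda>\<omega>. S (Y \<omega>))"
  define c where "c m = (\<Sum>n\<in>multi_indices d {m}.
    H n * (1 / (\<Prod>i\<in>I. fact (n i))) * (\<Prod>i\<in>I. sq_norm (\<mu>' i) (P' i (n i))))" for m
  define E where "E i k t = (\<integral>x. poly (P' i k) x * exp (t * x) \<partial>\<mu>' i)" for i k t
  have [simp]: "finite I"
    by (simp add: I_def)
  have \<mu>: "\<mu> i \<in> meixner_class u" "is_density_of L (\<phi> i) (\<mu> i)" if "i \<in> I" for i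
    using assms that by (auto simp: I_def)
  have \<mu>': "\<mu>' i \<in> meixner_class u'" "is_density_of L (\<phi>' i) (\<mu>' i)" "meixner_polys u' (\<mu>' i) (P' i)" if "i \<in> I" for i
    using assms that by (auto simp: I_def)
  \<comment> \<open>One radius is chosen for all 2d laws, so that every transform below is finite
    for the same t.\<close>
  have "\<forall>\<^sub>F \<epsilon> in at_right 0. (0::real) < \<epsilon> \<and> (\<forall>i\<in>I. exp_integrable_on (\<mu> i) \<epsilon>) \<and> (\<forall>i\<in>I. exp_integrable_on (\<mu>' i) \<epsilon>)"
    by (intro eventually_conj eventually_at_right_less exp_integrable_on_uniform[where u = u]
          exp_integrable_on_uniform[where u = u'] \<mu> \<mu>' \<open>finite I\<close>)
  then obtain \<epsilon> where "0 < \<epsilon>" and \<epsilon>: "\<And>i. i \<in> I \<Longrightarrow> exp_integrable_on (\<mu> i) \<epsilon>"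
      and \<epsilon>': "\<And>i. i \<in> I \<Longrightarrow> exp_integrable_on (\<mu>' i) \<epsilon>"
    using eventually_happens'[of "at_right (0::real)"] trivial_limit_at_right_real by blast

  \<comment> \<open>Measurability and the two joint densities\<close>
  have meas_comp [measurable]: "(\<lambda>x. x i) \<in> measurable M L" if "i \<in> I" for i
    using that by (simp add: M_def)
  have meas_S [measurable]: "S \<in> borel_measurable M"
  proof -
    have "(\<lambda>x. x i) \<in> borel_measurable M" if "i \<in> I" for i
      using meas_comp[OF that] \<open>sets L = sets borel\<close> measurable_cong_sets[OF refl] by blast
    thus ?thesis
      unfolding S_def by (rule borel_measurable_sum)
  qed
  have meas_\<phi>: "\<phi> i \<in> borel_measurable L" "AE x in L. 0 \<le> \<phi> i x" if "i \<in> I" for i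
    using \<mu>(2)[OF that] by (auto simp: is_density_of_def prob_density_def)
  have densX: "(\<lambda>x. \<Prod>i\<in>I. \<phi> i (x i)) \<in> borel_measurable M" "AE x in M. 0 \<le> (\<Prod>i\<in>I. \<phi> i (x i))"
  proof -
    show "(\<lambda>x. \<Prod>i\<in>I. \<phi> i (x i)) \<in> borel_measurable M"
      by (intro borel_measurable_prod measurable_compose[OF meas_comp meas_\<phi>(1)])
    show "AE x in M. 0 \<le> (\<Prod>i\<in>I. \<phi> i (x i))"
      unfolding M_def by (intro AE_PiM_prod_nonneg meas_\<phi> \<open>sigma_finite_measure L\<close> \<open>finite I\<close>)
  qed
  have densY: "f \<in> borel_measurable M" "AE x in M. 0 \<le> f x"
    using \<open>prob_density (Pi\<^sub>M {1..d} (\<lambda>_. L)) f\<close> unfolding prob_density_def M_def I_def by blast+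
  have distX: "distributed \<Omega>X M X (\<lambda>x. ennreal (\<Prod>i\<in>I. \<phi> i (x i)))"
    and distY: "distributed \<Omega>Y M Y (\<lambda>x. ennreal (f x))"
    using assms by (simp_all add: M_def I_def)
  note transX = distributed_transform_integral[OF distX densX meas_S, folded \<nu>X_def]
  note transY = distributed_transform_integral[OF distY densY meas_S, folded \<nu>Y_def]

  \<comment> \<open>Moment generating functions of the two sums\<close>
  have exp_S: "exp (t * S x) = (\<Prod>i\<in>I. exp (t * x i))" for t x
    by (simp add: S_def sum_distrib_left exp_sum)
  have intX: "integrable M (\<lambda>x. (\<Prod>i\<in>I. \<phi> i (x i)) * exp (t * S x))" if "\<bar>t\<bar> < \<epsilon>" for t
    unfolding exp_S M_def using \<epsilon> that
    by (intro product_density_integral[where \<mu> = \<mu>] \<mu> \<open>sigma_finite_measure L\<close> \<open>finite I\<close>)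
       (auto simp: exp_integrable_on_def)
  \<comment> \<open>This is one term of the perturbation multiplied by \<open>exp (t * S x)\<close>,
    with the exponential distributed over the coordinates so that its integral factors into the
    transforms \<open>E\<close>.\<close>
  define F where "F t n x = (\<Prod>i\<in>I. \<phi>' i (x i)) * (\<Prod>i\<in>I. poly (P' i (n i)) (x i) * exp (t * x i))"
    for t n and x :: "nat \<Rightarrow> real"
  have intF: "integrable M (F t n)" "integral\<^sup>L M (F t n) = (\<Prod>i\<in>I. E i (n i) t)" if "\<bar>t\<bar> < \<epsilon>" for t n
    unfolding F_def M_def E_def
    by (intro product_density_integral[where \<mu> = \<mu>'] \<mu>' \<open>sigma_finite_measure L\<close> \<open>finite I\<close>
          exp_integrable_on_poly_exp[OF \<epsilon>' that]; assumption)+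
  have f_exp: "f x * exp (t * S x) = (\<Prod>i\<in>I. \<phi> i (x i)) * exp (t * S x) +
      \<kappa> * (\<Sum>n\<in>multi_indices d {1..N}. H n * F t n x)" for t x
    unfolding \<open>f = _\<close> F_def exp_S I_def[symmetric] prod.distrib
    by (simp add: ring_distribs sum_distrib_left sum_distrib_right mult_ac)
  have intY: "integrable M (\<lambda>x. f x * exp (t * S x))" if "\<bar>t\<bar> < \<epsilon>" for t
    unfolding f_exp using intX intF that by simp
  have mgf_diff: "mgf \<nu>Y t - mgf \<nu>X t = \<kappa> * (\<Sum>n\<in>multi_indices d {1..N}. H n * (\<Prod>i\<in>I. E i (n i) t))"
    if "\<bar>t\<bar> < \<epsilon>" for t
    using intX intF that by (simp add: mgf_def transX(2) transY(2) f_exp)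

  \<comment> \<open>The difference of the transforms as a polynomial in z\<close>
  define Q where "Q = (\<Sum>m=1..N. monom (c m) m)"
  have coeff_Q: "coeff Q m = c m" if "m \<in> {1..N}" for m
    using that by (simp add: Q_def coeff_sum)
  \<comment> \<open>As \<open>u'\<close> tends to 0 at 0, statements valid for small t can be pulled
    back along t = \<open>u' z\<close>.\<close>
  have ev_u: "\<forall>\<^sub>F z in nhds 0. P (u' z)" if "\<forall>\<^sub>F t in nhds 0. P t" for P
    using that meixner_generator_tendsto[OF gen] by (rule eventually_compose_filterlim)
  have "\<forall>\<^sub>F z in nhds 0. \<bar>u' z\<bar> < \<epsilon>"
    using eventually_nhds_in_open[of "ball (0::real) \<epsilon>" 0] \<open>0 < \<epsilon>\<close>
    by (intro ev_u) (auto elim: eventually_mono)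
  \<comment> \<open>Finitely many pairs (i, k) share one neighbourhood; k up to N suffices, since no
    entry of a multi-index exceeds its total degree.\<close>
  moreover have "\<forall>\<^sub>F z in nhds 0. \<forall>i\<in>I. \<forall>k\<in>{..N}. E i k (u' z) =
      mgf (\<mu>' i) (u' z) * (sq_norm (\<mu>' i) (P' i k) / fact k * z ^ k)"
    unfolding E_def
    by (intro eventually_ball_finite ballI meixner_laplace_transform[OF gen] \<mu>') auto
  ultimately have key: "\<forall>\<^sub>F z in nhds 0. mgf \<nu>Y (u' z) = mgf \<nu>X (u' z) \<longleftrightarrow> poly Q z = 0"
  proof eventually_elim
    case (elim z)
    have le_N: "n i \<in> {..N}" if "n \<in> multi_indices d {1..N}" "i \<in> I" for n i
      using member_le_sum[of i I n] that by (simp add: multi_indices_def I_def)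
    \<comment> \<open>The product of the moment generating functions is the same for every
      multi-index and positive, so it factors out of the sum and cannot affect where the difference
      vanishes.\<close>
    define K where "K = (\<Prod>i\<in>I. mgf (\<mu>' i) (u' z))"
    have "mgf (\<mu>' i) (u' z) > 0" if "i \<in> I" for i
      using \<mu>'(1)[OF that] \<epsilon>'[OF that] elim(1)
      by (intro mgf_pos) (auto simp: meixner_class_def real_distribution_def exp_integrable_on_def)
    hence "K > 0"
      unfolding K_def by (intro prod_pos)
    have "(\<Sum>n\<in>multi_indices d {1..N}. H n * (\<Prod>i\<in>I. E i (n i) (u' z))) =
        (\<Sum>n\<in>multi_indices d {1..N}. H n * (K * ((\<Prod>i\<in>I. sq_norm (\<mu>' i) (P' i (n i))) /
            (\<Prod>i\<in>I. fact (n i)) * z ^ (\<Sum>i\<in>I. n i))))"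
      using elim(2) le_N by (intro sum.cong) (simp_all add: K_def prod.distrib prod_dividef power_sum)
    also have "\<dots> = (\<Sum>m=1..N. \<Sum>n\<in>multi_indices d {m}. H n * (K * ((\<Prod>i\<in>I. sq_norm (\<mu>' i) (P' i (n i))) /
            (\<Prod>i\<in>I. fact (n i)) * z ^ (\<Sum>i\<in>I. n i))))"
      by (rule sum_multi_indices_by_degree)
    also have "\<dots> = (\<Sum>m=1..N. K * (c m * z ^ m))"
    proof (rule sum.cong[OF refl])
      fix m
      have "(\<Sum>i\<in>I. n i) = m" if "n \<in> multi_indices d {m}" for n
        using that by (simp add: multi_indices_def I_def)
      thus "(\<Sum>n\<in>multi_indices d {m}. H n * (K * ((\<Prod>i\<in>I. sq_norm (\<mu>' i) (P' i (n i))) /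
            (\<Prod>i\<in>I. fact (n i)) * z ^ (\<Sum>i\<in>I. n i)))) = K * (c m * z ^ m)"
        unfolding c_def sum_distrib_left sum_distrib_right by (intro sum.cong) simp_all
    qed
    also have "\<dots> = K * poly Q z"
      by (simp add: Q_def poly_sum poly_monom sum_distrib_left)
    finally have "mgf \<nu>Y (u' z) - mgf \<nu>X (u' z) = \<kappa> * (K * poly Q z)"
      using mgf_diff elim(1) by simp
    with \<open>K > 0\<close> \<open>\<kappa> \<noteq> 0\<close> show ?case
      by auto
  qed

  \<comment> \<open>Equality of the laws and vanishing of the coefficients\<close>
  have "\<nu>Y = \<nu>X \<longleftrightarrow> (\<forall>m\<in>{1..N}. c m = 0)"
  proof
    assume "\<nu>Y = \<nu>X"
    with key have "Q = 0"
      by (intro poly_eq_0_if_eventually_0) simp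
    thus "\<forall>m\<in>{1..N}. c m = 0"
      using coeff_Q by simp
  next
    assume "\<forall>m\<in>{1..N}. c m = 0"
    hence "Q = 0"
      by (simp add: Q_def)
    with key have ev: "\<forall>\<^sub>F z in nhds 0. mgf \<nu>Y (u' z) = mgf \<nu>X (u' z)"
      by simp
    show "\<nu>Y = \<nu>X"
    proof (rule laplace_transform_identity)
      show "exp_integrable_on \<nu>Y \<epsilon>" "exp_integrable_on \<nu>X \<epsilon>"
        using intX intY transX(1) transY(1) by (simp_all add: exp_integrable_on_def \<nu>X_def \<nu>Y_def)
      \<comment> \<open>No inverse of \<open>u'\<close> is formed: for small nonzero z, the value
        \<open>u' z\<close> is itself a nonzero point of agreement in any given neighbourhood of
        0.\<close>
      show "0 islimpt {t. mgf \<nu>Y t = mgf \<nu>X t}"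
        unfolding islimpt_def
      proof safe
        fix T :: "real set" assume "0 \<in> T" "open T"
        hence "\<forall>\<^sub>F z in nhds 0. u' z \<in> T"
          by (intro ev_u eventually_nhds_in_open)
        with ev have "\<forall>\<^sub>F z in at 0. u' z \<in> T \<and> mgf \<nu>Y (u' z) = mgf \<nu>X (u' z)"
          by (intro eventually_conj) (auto simp: eventually_at_filter elim: eventually_mono)
        with meixner_generator_eventually_nonzero[OF gen]
        have "\<forall>\<^sub>F z in at 0. u' z \<noteq> 0 \<and> u' z \<in> T \<and> mgf \<nu>Y (u' z) = mgf \<nu>X (u' z)"
          by (rule eventually_conj)
        from eventually_happens'[OF at_neq_bot this]
        show "\<exists>y\<in>{t. mgf \<nu>Y t = mgf \<nu>X t}. y \<in> T \<and> y \<noteq> 0"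
          by blast
      qed
      have "(\<lambda>\<omega>. S (X \<omega>)) \<in> borel_measurable \<Omega>X" "(\<lambda>\<omega>. S (Y \<omega>)) \<in> borel_measurable \<Omega>Y"
        using distX distY by (auto simp: distributed_def intro: measurable_compose[OF _ meas_S])
      thus "real_distribution \<nu>Y" "real_distribution \<nu>X"
        unfolding \<nu>X_def \<nu>Y_def using \<open>prob_space \<Omega>X\<close> \<open>prob_space \<Omega>Y\<close>
        by (auto intro: prob_space.real_distribution_distr)
    qed fact
  qed
  thus ?thesis
    by (simp add: \<nu>X_def \<nu>Y_def S_def c_def I_def)
qed

end
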